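(* Let $s\ge2$, $2\le w<r<\overline{n}$, $N=w^{\overline{n}}$, $n=s\overline{n}$, $k=n-r$. Let $\lambda_{i,u}$ ($i\in[0:\overline{n})$, $u\in[0:w)$) be pairwise distinct elements of $\mathbf{F}_q$, $x_i\in\mathbf{F}_q\setminus\{0\}$ ($i\in[0:n)$), and $\xi_{i,u}=x_i\lambda_{\bar i,u}$ with $\bar i=i\%\overline{n}$. Assume that for all $i,j\in[0:n)$ and $u,v\in[0:w)$: $\xi_{i,u}\ne\xi_{j,v}$ if $j\not\equiv i\bmod\overline{n}$; $\xi_{i,u}\ne\xi_{j,u}$ if $j\ne i$ and $j\equiv i\bmod\overline{n}$; and $\xi_{i,u}\neq\xi_{i,v}$ if $u\ne v$. Let $\mathcal{C}_2$ be the $(n,k)$ MDS array code over $\mathbf{F}_q$ with parity-check matrix $(A_i^t)_{t\in[0:r),i\in[0:n)}$, $A_i=\sum_{a=0}^{N-1}\xi_{i,a_{\bar i}}e_a^\top e_a$. Then $\mathcal{C}_2$ has the optimal update property.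
   Context: Notation: $[a:b)=\{a,\dots,b-1\}$; $\%$ is the modulo operation; $A^0=I$. $e_0,\dots,e_{N-1}$ are the standard basis row vectors of $\mathbf{F}_q^N$; for $a\in[0:N)$, $(a_0,\dots,a_{\overline{n}-1})$ is its $w$-ary expansion with $a_0$ most significant. Array codes: an $(n,k)$ array code with parity-check matrix $(A_{t,i})_{t\in[0:r),i\in[0:n)}$ ($r=n-k$, $A_{t,i}\in\mathbf{F}_q^{N\times N}$) is the set of $(\mathbf{f}_0,\dots,\mathbf{f}_{n-1})$, $\mathbf{f}_i\in\mathbf{F}_q^N$ columns (node $i$ stores $\mathbf{f}_i$), with $\sum_iA_{t,i}\mathbf{f}_i=0$ for all $t\in[0:r)$. It is MDS if any $k$ nodes determine the codeword (and their contents can be chosen freely). Optimal update property of an $(n,k)$ MDS array code: only the minimum possible number of stored elements need to be updated when one information element is changed; i.e. for any $k$ nodes taken as information nodes, changing a single symbol stored in one of them changes exactly one symbol in each of the $r$ remaining nodes. *)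

theory Defs
  imports "Jordan_Normal_Form.Matrix"
begin

text \<open>A codeword is an extensional function from the node indices \<open>{..<n}\<close> to column vectors of
  length \<open>N\<close>.\<close>

definition array_code ::
  "nat \<Rightarrow> nat \<Rightarrow> nat \<Rightarrow> (nat \<Rightarrow> nat \<Rightarrow> 'a::field mat) \<Rightarrow> (nat \<Rightarrow> 'a vec) set" where
  "array_code n r N A =
    {f \<in> {..<n} \<rightarrow>\<^sub>E carrier_vec N.
      \<forall>t<r. finsum_vec TYPE('a) N (\<lambda>i. A t i *\<^sub>v f i) {..<n} = 0\<^sub>v N}"

text \<open>Uniqueness says that the nodes in \<open>K\<close> determine the codeword, existence that their contents
  can be chosen freely.\<close>

definition MDS_array_code :: "nat \<Rightarrow> nat \<Rightarrow> nat \<Rightarrow> (nat \<Rightarrow> 'a::field vec) set \<Rightarrow> bool" where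
  "MDS_array_code n k N C \<longleftrightarrow>
    (\<forall>K g. K \<subseteq> {..<n} \<longrightarrow> card K = k \<longrightarrow> g \<in> K \<rightarrow>\<^sub>E carrier_vec N \<longrightarrow>
      (\<exists>!c. c \<in> C \<and> (\<forall>i\<in>K. c i = g i)))"

text \<open>Here \<open>c\<close> and \<open>c'\<close> are the codewords before and after the update: on the information nodes
  \<open>K\<close> they differ in the symbol \<open>a\<close> of node \<open>i\<close> and nowhere else. The property is meaningful only
  for MDS codes, for which such a \<open>c'\<close> exists for every new value of that symbol.\<close>

definition optimal_update_property ::
  "nat \<Rightarrow> nat \<Rightarrow> nat \<Rightarrow> (nat \<Rightarrow> 'a::field vec) set \<Rightarrow> bool" where
  "optimal_update_property n k N C \<longleftrightarrow>
    (\<forall>K. K \<subseteq> {..<n} \<longrightarrow> card K = k \<longrightarrow>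
      (\<forall>i\<in>K. \<forall>a<N. \<forall>c\<in>C. \<forall>c'\<in>C.
        c i $ a \<noteq> c' i $ a \<longrightarrow>
        (\<forall>l\<in>K. \<forall>b<N. (l, b) \<noteq> (i, a) \<longrightarrow> c l $ b = c' l $ b) \<longrightarrow>
        (\<forall>j\<in>{..<n} - K. card {b. b < N \<and> c j $ b \<noteq> c' j $ b} = 1)))"

text \<open>The \<open>w\<close>-ary digit \<open>a\<^sub>i\<close> of \<open>a < w ^ m\<close> written with \<open>m\<close> digits, \<open>a\<^sub>0\<close> being the most
  significant one.\<close>

definition digit :: "nat \<Rightarrow> nat \<Rightarrow> nat \<Rightarrow> nat \<Rightarrow> nat" where
  "digit w m a i = a div w ^ (m - 1 - i) mod w"

definition e_row :: "nat \<Rightarrow> nat \<Rightarrow> 'a::field mat" where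
  "e_row N a = mat_of_rows N [unit_vec N a]"

text \<open>The matrix \<open>A\<^sub>i\<close> for \<open>N = w ^ m\<close>, where \<open>m\<close> is the number of residue classes of nodes.\<close>

definition A_mat :: "nat \<Rightarrow> nat \<Rightarrow> (nat \<Rightarrow> nat \<Rightarrow> 'a::field) \<Rightarrow> nat \<Rightarrow> 'a mat" where
  "A_mat w m \<xi> i =
    (let N = w ^ m in
      finsum (module_mat TYPE('a) N N)
        (\<lambda>a. \<xi> i (digit w m a (i mod m)) \<cdot>\<^sub>m (transpose_mat (e_row N a) * e_row N a)) {..<N})"

definition C2 ::
  "nat \<Rightarrow> nat \<Rightarrow> nat \<Rightarrow> nat \<Rightarrow> (nat \<Rightarrow> nat \<Rightarrow> 'a::field) \<Rightarrow> (nat \<Rightarrow> 'a vec) set" where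
  "C2 n r w m \<xi> = array_code n r (w ^ m) (\<lambda>t i. A_mat w m \<xi> i ^\<^sub>m t)"

lemma index_finsum_module_mat:
  fixes F :: "'b \<Rightarrow> 'a::field mat"
  assumes "finite S" "\<And>a. a \<in> S \<Longrightarrow> F a \<in> carrier_mat N N" "p < N" "q < N"
  shows "finsum (module_mat TYPE('a) N N) F S \<in> carrier_mat N N \<and>
    finsum (module_mat TYPE('a) N N) F S $$ (p, q) = (\<Sum>a\<in>S. F a $$ (p, q))"
proof -
  interpret M: abelian_group "module_mat TYPE('a) N N"
    by (rule abelian_group_mat)
  show ?thesis
    using assms(1,2)
  proof (induction S rule: finite_induct)
    case empty
    show ?case using assms(3,4) by (simp only: M.finsum_empty) (simp add: module_mat_simps)
  next
    case (insert x S)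
    have IH: "finsum (module_mat TYPE('a) N N) F S \<in> carrier_mat N N"
      "finsum (module_mat TYPE('a) N N) F S $$ (p, q) = (\<Sum>a\<in>S. F a $$ (p, q))"
      using insert by auto
    have "finsum (module_mat TYPE('a) N N) F (insert x S)
        = F x + finsum (module_mat TYPE('a) N N) F S"
      using insert by (subst M.finsum_insert) (auto simp: module_mat_simps)
    then show ?case
      using IH insert assms(3,4) by auto
  qed
qed

lemma A_mat_index:
  assumes "p < w ^ m" "q < w ^ m"
  shows "A_mat w m \<xi> i $$ (p, q) = (if p = q then \<xi> i (digit w m p (i mod m)) else 0)"
proof -
  have "A_mat w m \<xi> i $$ (p, q) =
    (\<Sum>a<w ^ m. \<xi> i (digit w m a (i mod m)) * (if a = p \<and> a = q then 1 else 0))"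
    unfolding A_mat_def Let_def using assms
    by (subst index_finsum_module_mat[THEN conjunct2])
      (auto simp: e_row_def scalar_prod_def mat_of_rows_def intro!: sum.cong)
  also have "\<dots> = (\<Sum>a<w ^ m. if a = p then (if p = q then \<xi> i (digit w m p (i mod m)) else 0) else 0)"
    by (rule sum.cong) auto
  also have "\<dots> = (if p = q then \<xi> i (digit w m p (i mod m)) else 0)"
    using assms by simp
  finally show ?thesis .
qed

end

theory Submission
  imports Defs "HOL-Computational_Algebra.Polynomial"
begin

text \<open>All matrices \<open>A\<^sub>i\<close> are diagonal, so the parity checks decouple into the \<open>N\<close> rows. By the
  assumptions on \<open>\<xi>\<close>, the \<open>n\<close> diagonal entries that occur in one row are distinct, so each row
  is a generalized Reed-Solomon code with a Vandermonde parity-check matrix: any \<open>n - r\<close> symbols of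
  a row determine the other \<open>r\<close>. An update of one information symbol only touches its own row, and
  there it must change every parity symbol, since a nonzero word of the row code has weight
  at least \<open>r + 1\<close>.\<close>

section \<open>Vandermonde systems over a field\<close>

lemma poly_eq_sum_coeff:
  fixes p :: "'a::comm_ring_1 poly"
  assumes "degree p < r"
  shows "poly p x = (\<Sum>t<r. coeff p t * x ^ t)"
  unfolding poly_altdef
  by (rule sum.mono_neutral_left) (use assms in \<open>auto simp: coeff_eq_0\<close>)

text \<open>The coefficients of the Lagrange basis polynomials form the inverse of the Vandermonde
  matrix.\<close>

lemma Lagrange_basis_exists:
  fixes y :: "'b \<Rightarrow> 'a::field"
  assumes "finite S" "inj_on y S"
  obtains L where "\<And>i. i \<in> S \<Longrightarrow> degree (L i) < card S"
    and "\<And>i j. i \<in> S \<Longrightarrow> j \<in> S \<Longrightarrow> poly (L i) (y j) = (if i = j then 1 else 0)"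
proof
  define L where
    "L i = smult (inverse (\<Prod>l\<in>S - {i}. y i - y l)) (\<Prod>l\<in>S - {i}. [:- y l, 1:])" for i
  fix i assume i: "i \<in> S"
  have "degree (L i) \<le> degree (\<Prod>l\<in>S - {i}. [:- y l, 1:])"
    unfolding L_def by (rule degree_smult_le)
  also have "\<dots> = card (S - {i})"
    by (subst degree_prod_eq_sum_degree) auto
  also have "\<dots> < card S"
    using i assms(1) by (intro card_Diff1_less)
  finally show "degree (L i) < card S" .
  have nz: "(\<Prod>l\<in>S - {i}. y i - y l) \<noteq> 0"
    using assms i by (auto simp: inj_on_def)
  fix j assume j: "j \<in> S"
  show "poly (L i) (y j) = (if i = j then 1 else 0)"
  proof (cases "i = j")
    case True
    then show ?thesis using nz by (simp add: L_def poly_prod)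
  next
    case False
    \<comment> \<open>The factor with \<open>l = j\<close> is among those taken and
      vanishes.\<close>
    then have "(\<Prod>l\<in>S - {i}. y j - y l) = 0"
      using assms(1) j by auto
    then show ?thesis using False by (simp add: L_def poly_prod)
  qed
qed

text \<open>Combining the equations with the coefficients of the Lagrange polynomial
  \<open>L i\<close> as weights isolates the unknown \<open>f i\<close>.\<close>

lemma Vandermonde_kernel_trivial:
  fixes y :: "'b \<Rightarrow> 'a::field"
  assumes "finite S" "inj_on y S"
    and eq: "\<And>t. t < card S \<Longrightarrow> (\<Sum>i\<in>S. y i ^ t * f i) = 0"
    and "i \<in> S"
  shows "f i = 0"
proof -
  obtain L where L: "\<And>i. i \<in> S \<Longrightarrow> degree (L i) < card S"
    "\<And>i j. i \<in> S \<Longrightarrow> j \<in> S \<Longrightarrow> poly (L i) (y j) = (if i = j then 1 else 0)"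
    using Lagrange_basis_exists[OF assms(1,2)] by metis
  have "f i = (\<Sum>j\<in>S. poly (L i) (y j) * f j)"
    using assms(1,4) L(2) by (simp add: if_distrib[of "\<lambda>c. c * _"] cong: if_cong)
  also have "\<dots> = (\<Sum>j\<in>S. \<Sum>t<card S. coeff (L i) t * (y j ^ t * f j))"
    by (simp add: poly_eq_sum_coeff[OF L(1)[OF assms(4)]] sum_distrib_right mult.assoc)
  also have "\<dots> = (\<Sum>t<card S. coeff (L i) t * (\<Sum>j\<in>S. y j ^ t * f j))"
    by (subst sum.swap) (simp add: sum_distrib_left)
  also have "\<dots> = 0"
    using eq by simp
  finally show ?thesis .
qed

text \<open>The solution is the inverse matrix applied to \<open>h\<close>; that it works says that
  Lagrange interpolation reproduces the monomials of degree below \<open>card S\<close>.\<close>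

lemma Vandermonde_solvable:
  fixes y :: "'b \<Rightarrow> 'a::field"
  assumes "finite S" "inj_on y S"
  obtains f where "\<And>t. t < card S \<Longrightarrow> (\<Sum>i\<in>S. y i ^ t * f i) = h t"
proof -
  obtain L where L: "\<And>i. i \<in> S \<Longrightarrow> degree (L i) < card S"
    "\<And>i j. i \<in> S \<Longrightarrow> j \<in> S \<Longrightarrow> poly (L i) (y j) = (if i = j then 1 else 0)"
    using Lagrange_basis_exists[OF assms] by metis
  have "(\<Sum>i\<in>S. y i ^ t * (\<Sum>u<card S. coeff (L i) u * h u)) = h t" if t: "t < card S" for t
  proof -
    have interp: "(\<Sum>i\<in>S. smult (y i ^ t) (L i)) = monom 1 t"
    proof (rule poly_eqI_degree)
      fix z assume "z \<in> y ` S"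
      then obtain j where j: "j \<in> S" "z = y j" by auto
      have "(\<Sum>i\<in>S. y i ^ t * poly (L i) (y j)) = (\<Sum>i\<in>S. if i = j then y i ^ t else 0)"
        using L(2) j by (intro sum.cong) auto
      then show "poly (\<Sum>i\<in>S. smult (y i ^ t) (L i)) z = poly (monom 1 t) z"
        using assms(1) j by (simp add: poly_sum poly_monom)
    next
      show "degree (\<Sum>i\<in>S. smult (y i ^ t) (L i)) < card (y ` S)"
        using t assms(2) L(1)
        by (auto simp: card_image intro!: degree_sum_less le_less_trans[OF degree_smult_le])
      show "degree (monom (1::'a) t) < card (y ` S)"
        using t assms(2) by (simp add: card_image degree_monom_eq)
    qed
    have "(\<Sum>i\<in>S. y i ^ t * (\<Sum>u<card S. coeff (L i) u * h u)) =
        (\<Sum>u<card S. (\<Sum>i\<in>S. y i ^ t * coeff (L i) u) * h u)"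
      by (simp add: sum_distrib_left sum_distrib_right mult.assoc) (rule sum.swap)
    also have "\<dots> = (\<Sum>u<card S. coeff (monom 1 t) u * h u)"
      by (simp add: interp[symmetric] coeff_sum)
    also have "\<dots> = (\<Sum>u<card S. if t = u then h u else 0)"
      by (rule sum.cong) auto
    also have "\<dots> = h t"
      using t by simp
    finally show ?thesis .
  qed
  then show thesis by (rule that)
qed

section \<open>Array codes with diagonal parity-check matrices\<close>

lemma mat_diag_pow: "mat_diag N d ^\<^sub>m t = mat_diag N (\<lambda>b. d b ^ t)"
  for d :: "nat \<Rightarrow> 'a::comm_semiring_1"
proof (induction t)
  case 0
  then show ?case by (simp add: mat_diag_def)
next
  case (Suc t)
  then show ?case by (simp add: mult.commute)
qed

lemma index_mat_diag_mult_vec: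
  assumes "v \<in> carrier_vec N" "b < N"
  shows "(mat_diag N d *\<^sub>v v) $ b = d b * v $ b"
  using assms
  by (simp add: mat_diag_def scalar_prod_def if_distrib[of "\<lambda>c. c * _"] cong: if_cong)

text \<open>Powers of a diagonal matrix are diagonal, so entry \<open>b\<close> of a parity check
  involves only the symbols at position \<open>b\<close> of the nodes.\<close>

lemma array_code_mat_diag:
  fixes y :: "nat \<Rightarrow> nat \<Rightarrow> 'a::field"
  shows "array_code n r N (\<lambda>t i. mat_diag N (y i) ^\<^sub>m t) =
    {f \<in> {..<n} \<rightarrow>\<^sub>E carrier_vec N. \<forall>t<r. \<forall>b<N. (\<Sum>i<n. y i b ^ t * f i $ b) = 0}"
proof -
  have "finsum_vec TYPE('a) N (\<lambda>i. mat_diag N (y i) ^\<^sub>m t *\<^sub>v f i) {..<n} = 0\<^sub>v N \<longleftrightarrow>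
      (\<forall>b<N. (\<Sum>i<n. y i b ^ t * f i $ b) = 0)" (is "?v = _ \<longleftrightarrow> _")
    if f: "f \<in> {..<n} \<rightarrow>\<^sub>E carrier_vec N" for f t
  proof -
    have c: "(\<lambda>i. mat_diag N (y i) ^\<^sub>m t *\<^sub>v f i) \<in> {..<n} \<rightarrow> carrier_vec N"
      using f by (auto simp: mat_diag_pow intro!: mult_mat_vec_carrier mat_diag_dim)
    have "?v \<in> carrier_vec N"
      by (rule finsum_vec_closed[OF c])
    moreover have "?v $ b = (\<Sum>i<n. y i b ^ t * f i $ b)" if "b < N" for b
      using f that unfolding index_finsum_vec[OF finite_lessThan that c]
      by (intro sum.cong) (auto simp: mat_diag_pow intro!: index_mat_diag_mult_vec)
    ultimately show ?thesis
      by (auto simp: vec_eq_iff)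
  qed
  then show ?thesis
    unfolding array_code_def by blast
qed

text \<open>Once the nodes in \<open>K\<close> are fixed, each row leaves a square Vandermonde
  system of size \<open>r\<close> for the other nodes.\<close>

lemma MDS_array_code_mat_diag:
  fixes y :: "nat \<Rightarrow> nat \<Rightarrow> 'a::field"
  assumes "r \<le> n" and inj: "\<And>b. b < N \<Longrightarrow> inj_on (\<lambda>i. y i b) {..<n}"
  shows "MDS_array_code n (n - r) N (array_code n r N (\<lambda>t i. mat_diag N (y i) ^\<^sub>m t))"
  unfolding MDS_array_code_def array_code_mat_diag
proof (intro allI impI)
  fix K and g :: "nat \<Rightarrow> 'a vec"
  assume K: "K \<subseteq> {..<n}" "card K = n - r" and g: "g \<in> K \<rightarrow>\<^sub>E carrier_vec N"
  define P where "P = {..<n} - K"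
  have finK: "finite K" using K(1) finite_subset by blast
  have P: "finite P" "card P = r" "P \<inter> K = {}" "P \<union> K = {..<n}"
    using K assms(1) finK by (auto simp: P_def card_Diff_subset)
  have injP: "inj_on (\<lambda>i. y i b) P" if "b < N" for b
    using inj[OF that] by (rule inj_on_subset) (auto simp: P_def)
  have split: "(\<Sum>i<n. F i) = (\<Sum>i\<in>P. F i) + (\<Sum>i\<in>K. F i)" for F :: "nat \<Rightarrow> 'a"
    unfolding P(4)[symmetric] using P finK by (intro sum.union_disjoint) auto
  \<comment> \<open>The rows are solved one by one, with the known contribution of \<open>K\<close>
    on the right-hand side; the guard \<open>b < N\<close> sits under the existential so that choice
    over all \<open>b\<close> applies.\<close>
  have "\<forall>b. \<exists>F. b < N \<longrightarrow> (\<forall>t<r. (\<Sum>i\<in>P. y i b ^ t * F i) = - (\<Sum>i\<in>K. y i b ^ t * g i $ b))"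
  proof
    fix b
    show "\<exists>F. b < N \<longrightarrow> (\<forall>t<r. (\<Sum>i\<in>P. y i b ^ t * F i) = - (\<Sum>i\<in>K. y i b ^ t * g i $ b))"
      using Vandermonde_solvable[OF P(1) injP, of b "\<lambda>t. - (\<Sum>i\<in>K. y i b ^ t * g i $ b)"] P(2)
      by metis
  qed
  from choice[OF this] obtain F where F: "\<And>b t. b < N \<Longrightarrow> t < r \<Longrightarrow>
      (\<Sum>i\<in>P. y i b ^ t * F b i) = - (\<Sum>i\<in>K. y i b ^ t * g i $ b)"
    by blast
  define c where "c = (\<lambda>i\<in>{..<n}. if i \<in> K then g i else vec N (\<lambda>b. F b i))"
  show "\<exists>!c. c \<in> {f \<in> {..<n} \<rightarrow>\<^sub>E carrier_vec N.
      \<forall>t<r. \<forall>b<N. (\<Sum>i<n. y i b ^ t * f i $ b) = 0} \<and> (\<forall>i\<in>K. c i = g i)"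
  proof (rule ex1I[of _ c], intro conjI CollectI allI impI ballI)
    show "c \<in> {..<n} \<rightarrow>\<^sub>E carrier_vec N"
      using g by (auto simp: c_def)
    show "c i = g i" if "i \<in> K" for i
      using that K by (auto simp: c_def)
    fix t b assume tb: "t < r" "b < N"
    have "(\<Sum>i\<in>P. y i b ^ t * c i $ b) = (\<Sum>i\<in>P. y i b ^ t * F b i)"
      using tb by (intro sum.cong) (auto simp: c_def P_def)
    moreover have "(\<Sum>i\<in>K. y i b ^ t * c i $ b) = (\<Sum>i\<in>K. y i b ^ t * g i $ b)"
      using K by (intro sum.cong) (auto simp: c_def)
    ultimately show "(\<Sum>i<n. y i b ^ t * c i $ b) = 0"
      using F tb by (simp add: split)
  next
    fix d
    assume "d \<in> {f \<in> {..<n} \<rightarrow>\<^sub>E carrier_vec N.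
      \<forall>t<r. \<forall>b<N. (\<Sum>i<n. y i b ^ t * f i $ b) = 0} \<and> (\<forall>i\<in>K. d i = g i)"
    then have d: "d \<in> {..<n} \<rightarrow>\<^sub>E carrier_vec N"
      "\<And>t b. t < r \<Longrightarrow> b < N \<Longrightarrow> (\<Sum>i<n. y i b ^ t * d i $ b) = 0" "\<And>i. i \<in> K \<Longrightarrow> d i = g i"
      by auto
    \<comment> \<open>Uniqueness: two solutions of the same row system differ by an element of the
      trivial kernel.\<close>
    have dP: "d i $ b = F b i" if b: "b < N" and i: "i \<in> P" for b i
    proof -
      have "d i $ b - F b i = 0"
      proof (rule Vandermonde_kernel_trivial[OF P(1) injP[OF b] _ i])
        fix t assume "t < card P"
        then have "t < r" using P(2) by simp
        have "(\<Sum>i\<in>K. y i b ^ t * d i $ b) = (\<Sum>i\<in>K. y i b ^ t * g i $ b)"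
          using d(3) by simp
        then have "(\<Sum>i\<in>P. y i b ^ t * d i $ b) = - (\<Sum>i\<in>K. y i b ^ t * g i $ b)"
          using d(2)[OF \<open>t < r\<close> b] by (simp add: split eq_neg_iff_add_eq_0)
        then show "(\<Sum>i\<in>P. y i b ^ t * (d i $ b - F b i)) = 0"
          using F[OF b \<open>t < r\<close>] by (simp add: right_diff_distrib sum_subtractf)
      qed
      then show ?thesis by simp
    qed
    show "d = c"
    proof
      fix i
      show "d i = c i"
      proof (cases "i < n")
        case False
        then show ?thesis using d(1) by (auto simp: c_def)
      next
        case True
        then have "i \<in> P \<or> i \<in> K" "d i \<in> carrier_vec N" using P(4) d(1) by auto
        then show ?thesis
          using True d(3) dP by (cases "i \<in> K") (auto simp: c_def intro!: eq_vecI)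
      qed
    qed
  qed
qed

lemma optimal_update_property_mat_diag:
  fixes y :: "nat \<Rightarrow> nat \<Rightarrow> 'a::field"
  assumes "r \<le> n" and inj: "\<And>b. b < N \<Longrightarrow> inj_on (\<lambda>i. y i b) {..<n}"
  shows "optimal_update_property n (n - r) N (array_code n r N (\<lambda>t i. mat_diag N (y i) ^\<^sub>m t))"
  unfolding optimal_update_property_def array_code_mat_diag
proof (intro allI impI ballI)
  fix K i a j and c c' :: "nat \<Rightarrow> 'a vec"
  let ?C = "{f \<in> {..<n} \<rightarrow>\<^sub>E carrier_vec N. \<forall>t<r. \<forall>b<N. (\<Sum>i<n. y i b ^ t * f i $ b) = 0}"
  assume K: "K \<subseteq> {..<n}" "card K = n - r" and i: "i \<in> K" and a: "a < N"
    and c: "c \<in> ?C" "c' \<in> ?C" and ne: "c i $ a \<noteq> c' i $ a"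
    and eq: "\<forall>l\<in>K. \<forall>b<N. (l, b) \<noteq> (i, a) \<longrightarrow> c l $ b = c' l $ b"
    and j: "j \<in> {..<n} - K"
  define P where "P = {..<n} - K"
  have P: "finite P" "card P = r"
    using K assms(1) finite_subset[OF K(1)] by (auto simp: P_def card_Diff_subset)
  define d where "d b l = c l $ b - c' l $ b" for b l
  \<comment> \<open>By linearity each row of \<open>d\<close> satisfies the parity checks of its row
    code, so it is zero if it is supported on only \<open>r\<close> nodes.\<close>
  have vanish: "d b l = 0"
    if b: "b < N" and S: "S \<subseteq> {..<n}" "card S = r" and out: "\<And>l. l < n \<Longrightarrow> l \<notin> S \<Longrightarrow> d b l = 0"
      and l: "l \<in> S" for b S l
  proof (rule Vandermonde_kernel_trivial[OF _ _ _ l])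
    show "finite S" using S(1) finite_subset by blast
    show "inj_on (\<lambda>i. y i b) S" using inj[OF b] S(1) by (rule inj_on_subset)
    fix t assume "t < card S"
    then have "(\<Sum>l<n. y l b ^ t * d b l) = 0"
      using c b S(2) by (simp add: d_def right_diff_distrib sum_subtractf)
    moreover have "(\<Sum>l\<in>S. y l b ^ t * d b l) = (\<Sum>l<n. y l b ^ t * d b l)"
      using S(1) out by (intro sum.mono_neutral_left) auto
    ultimately show "(\<Sum>l\<in>S. y l b ^ t * d b l) = 0" by simp
  qed
  \<comment> \<open>Such a row is unchanged on all of \<open>K\<close>, hence supported on the
    \<open>r\<close> nodes of \<open>P\<close>.\<close>
  have other: "d b j = 0" if "b < N" "b \<noteq> a" for b
    using vanish[OF that(1), of P j] that P(2) eq j by (auto simp: P_def d_def)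
  have "d a j \<noteq> 0"
  proof
    assume 0: "d a j = 0"
    \<comment> \<open>If the symbol of \<open>j\<close> were unchanged, \<open>i\<close> could take
      its place in the support of row \<open>a\<close>; the support would still fit into
      \<open>r\<close> nodes, which forces \<open>d a i = 0\<close>.\<close>
    have "card (insert i (P - {j})) = r"
      using P i j card_Suc_Diff1[of P j] by (simp add: P_def)
    then have "d a i = 0"
      using i j K(1) a eq 0
      by - (rule vanish[of a "insert i (P - {j})"], auto simp: P_def d_def)
    then show False using ne by (simp add: d_def)
  qed
  then have "{b. b < N \<and> c j $ b \<noteq> c' j $ b} = {a}"
    using other a by (auto simp: d_def)
  then show "card {b. b < N \<and> c j $ b \<noteq> c' j $ b} = 1" by simp
qed

section \<open>The matrices of \<open>C2\<close>\<close>

lemma A_mat_eq_mat_diag: "A_mat w m \<xi> i = mat_diag (w ^ m) (\<lambda>b. \<xi> i (digit w m b (i mod m)))"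
proof -
  interpret M: abelian_group "module_mat TYPE('a) (w ^ m) (w ^ m)"
    by (rule abelian_group_mat)
  \<comment> \<open>The entries are given by \<open>A_mat_index\<close>; the dimensions follow from
    closure of the carrier under sums.\<close>
  have "A_mat w m \<xi> i \<in> carrier (module_mat TYPE('a) (w ^ m) (w ^ m))"
    unfolding A_mat_def Let_def
    by (rule M.finsum_closed) (auto simp: module_mat_simps e_row_def mat_of_rows_def)
  then have "A_mat w m \<xi> i \<in> carrier_mat (w ^ m) (w ^ m)"
    by (simp add: module_mat_simps)
  then show ?thesis
    by (intro eq_matI) (auto simp: mat_diag_def A_mat_index)
qed

theorem proposition2:
  fixes s w r nbar N n k :: nat
    and lam \<xi> :: "nat \<Rightarrow> nat \<Rightarrow> 'a::{finite,field}"
    and x :: "nat \<Rightarrow> 'a"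
  assumes "2 \<le> s" and "2 \<le> w" and "w < r" and "r < nbar"
    and "N = w ^ nbar" and "n = s * nbar" and "k = n - r"
    and "inj_on (\<lambda>(i, u). lam i u) ({..<nbar} \<times> {..<w})"
    and "\<forall>i<n. x i \<noteq> 0"
    and "\<forall>i<n. \<forall>u<w. \<xi> i u = x i * lam (i mod nbar) u"
    and "\<forall>i<n. \<forall>j<n. \<forall>u<w. \<forall>v<w. j mod nbar \<noteq> i mod nbar \<longrightarrow> \<xi> i u \<noteq> \<xi> j v"
    and "\<forall>i<n. \<forall>j<n. \<forall>u<w. j \<noteq> i \<and> j mod nbar = i mod nbar \<longrightarrow> \<xi> i u \<noteq> \<xi> j u"
    and "\<forall>i<n. \<forall>u<w. \<forall>v<w. u \<noteq> v \<longrightarrow> \<xi> i u \<noteq> \<xi> i v"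
  shows "MDS_array_code n k N (C2 n r w nbar \<xi>) \<and>
    optimal_update_property n k N (C2 n r w nbar \<xi>)"
proof -
  define y where "y i b = \<xi> i (digit w nbar b (i mod nbar))" for i b
  have C: "C2 n r w nbar \<xi> = array_code n r N (\<lambda>t i. mat_diag N (y i) ^\<^sub>m t)"
    unfolding C2_def A_mat_eq_mat_diag y_def \<open>N = w ^ nbar\<close> ..
  have "nbar \<le> n"
    using assms(1,6) by simp
  then have "r \<le> n"
    using assms(4) by simp
  \<comment> \<open>The assumptions on \<open>\<xi>\<close> only cover second arguments below
    \<open>w\<close>.\<close>
  have digit: "digit w nbar b l < w" for b l
    using assms(2) by (simp add: digit_def)
  have inj: "inj_on (\<lambda>i. y i b) {..<n}" for b
  proof (rule inj_onI, rule ccontr)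
    fix i j assume ij: "i \<in> {..<n}" "j \<in> {..<n}" "y i b = y j b" "i \<noteq> j"
    show False
    proof (cases "j mod nbar = i mod nbar")
      case True
      \<comment> \<open>Congruent nodes read the same digit of \<open>b\<close>, so only values of
        \<open>\<xi>\<close> with equal second argument are compared.\<close>
      then show False using assms(12) ij digit unfolding y_def by (metis lessThan_iff)
    next
      case False
      \<comment> \<open>Here the two digits may differ, which this assumption allows for.\<close>
      then show False using assms(11) ij digit unfolding y_def by (metis lessThan_iff)
    qed
  qed
  show ?thesis
    unfolding C \<open>k = n - r\<close>
    using MDS_array_code_mat_diag[of r n N y] optimal_update_property_mat_diag[of r n N y]
      \<open>r \<le> n\<close> inj
    by blast
qed

end
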